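(* Let $\lambda$ be a nonzero real number and $r$ a positive integer. As formal power series in $t$ (with $x$ a variable), $$e^{x(e_{\lambda}^{-1}(-t)-1)}e_{\lambda}^{-r}(-t)=\sum_{n=0}^{\infty}H_{n,\lambda}^{(r)}(x)\frac{t^{n}}{n!}.$$
   Context: For $\lambda\in\mathbb{R}$, $\lambda\neq 0$: $(x)_{0,\lambda}=1$, $(x)_{n,\lambda}=x(x-\lambda)\cdots(x-(n-1)\lambda)$ for $n\ge 1$; $\langle x\rangle_{0,\lambda}=1$, $\langle x\rangle_{n,\lambda}=x(x+\lambda)\cdots(x+(n-1)\lambda)$ for $n\ge 1$. The falling factorial is $(x)_0=1$, $(x)_n=x(x-1)\cdots(x-n+1)$ for $n\ge 1$. The degenerate exponential is the series $e_{\lambda}^{x}(t)=\sum_{n=0}^{\infty}(x)_{n,\lambda}\frac{t^n}{n!}$ (that is, $(1+\lambda t)^{x/\lambda}$); $e_\lambda^{-r}(-t)$ denotes $e_\lambda^{x}(s)$ at $x=-r$, $s=-t$ (that is, $(1-\lambda t)^{-r/\lambda}$), and similarly for $e_\lambda^{-1}(-t)$. For a positive integer $r$, the heterogeneous $r$-Stirling numbers of the second kind $H_\lambda^{(r)}(n+r,k+r)$, $0\le k\le n$, are defined by the polynomial identity $\langle x+r\rangle_{n,\lambda}=\sum_{k=0}^{n}H_{\lambda}^{(r)}(n+r,k+r)(x)_{k}$ for $n\ge 0$. The heterogeneous $r$-Bell polynomials are $H_{n,\lambda}^{(r)}(x)=\sum_{k=0}^{n}x^{k}H_{\lambda}^{(r)}(n+r,k+r)$,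 $n\ge 0$. *)

theory Defs
  imports "HOL-Computational_Algebra.Computational_Algebra"
begin

definition degen_falling :: "'a::comm_ring_1 \<Rightarrow> 'a \<Rightarrow> nat \<Rightarrow> 'a" where
  "degen_falling lam x n = (\<Prod>i<n. x - of_nat i * lam)"

definition degen_rising :: "'a::comm_ring_1 \<Rightarrow> 'a \<Rightarrow> nat \<Rightarrow> 'a" where
  "degen_rising lam x n = (\<Prod>i<n. x + of_nat i * lam)"

definition falling :: "'a::comm_ring_1 \<Rightarrow> nat \<Rightarrow> 'a" where
  "falling x n = (\<Prod>i<n. x - of_nat i)"

definition degen_exp :: "real \<Rightarrow> real \<Rightarrow> real fps" where
  "degen_exp lam x = Abs_fps (\<lambda>n. degen_falling lam x n / fact n)"

abbreviation pvar :: "real poly" where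
  "pvar \<equiv> [:0, 1:]"

text \<open>The numbers \<open>H(n + r, k + r)\<close>, indexed here by \<open>n\<close> and \<open>k\<close>, are the coefficients of
  \<open>\<langle>x + r\<rangle>\<^sub>n\<close> (with parameter \<open>lam\<close>) in the basis of falling factorials. They are set to 0 for
  \<open>k > n\<close>; the existence and uniqueness behind \<open>THE\<close> is \<open>het_stirling_ex1\<close> below.\<close>

definition het_stirling :: "real \<Rightarrow> nat \<Rightarrow> nat \<Rightarrow> nat \<Rightarrow> real" where
  "het_stirling lam r n = (THE c. (\<forall>k>n. c k = 0) \<and>
     degen_rising [:lam:] (pvar + of_nat r) n = (\<Sum>k\<le>n. smult (c k) (falling pvar k)))"

definition het_bell :: "real \<Rightarrow> nat \<Rightarrow> nat \<Rightarrow> real poly" where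
  "het_bell lam r n = (\<Sum>k\<le>n. smult (het_stirling lam r n k) (pvar ^ k))"

text \<open>The coefficientwise embedding of \<open>\<real>[[t]]\<close> into \<open>\<real>[x][[t]]\<close>.\<close>

definition fps_lift :: "real fps \<Rightarrow> real poly fps" where
  "fps_lift f = Abs_fps (\<lambda>n. [:fps_nth f n:])"

lemma falling_pvar_degree: "degree (falling pvar k) = k"
  and falling_pvar_lead: "coeff (falling pvar k) k = 1"
proof -
  have "degree (falling pvar k) = k \<and> lead_coeff (falling pvar k) = 1"
  proof (induction k)
    case 0
    then show ?case by (simp add: falling_def)
  next
    case (Suc k)
    have lin: "pvar - of_nat k = [:- real k, 1:]"
      by (simp add: of_nat_poly)
    have rec: "falling pvar (Suc k) = falling pvar k * [:- real k, 1:]"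
      unfolding falling_def by (simp only: prod.lessThan_Suc lin)
    from Suc have "falling pvar k \<noteq> 0" by auto
    then have "degree (falling pvar (Suc k)) = Suc k"
      using Suc unfolding rec by (subst degree_mult_eq) auto
    moreover have "lead_coeff (falling pvar (Suc k)) = 1"
      unfolding rec lead_coeff_mult using conjunct2[OF Suc] by simp
    ultimately show ?case by blast
  qed
  then have deg: "degree (falling pvar k) = k" and lead: "lead_coeff (falling pvar k) = 1"
    by blast+
  show "degree (falling pvar k) = k" by (rule deg)
  show "coeff (falling pvar k) k = 1" using lead unfolding deg .
qed

lemma coeff_falling_sum:
  "coeff (\<Sum>k\<le>n. smult (c k) (falling pvar k)) n = c n"
proof -
  have "coeff (\<Sum>k\<le>n. smult (c k) (falling pvar k)) n
      = (\<Sum>k\<le>n. c k * coeff (falling pvar k) n)"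
    by (simp add: coeff_sum)
  also have "\<dots> = (\<Sum>k\<le>n. if k = n then c n else 0)"
    by (rule sum.cong) (auto simp: falling_pvar_lead falling_pvar_degree intro!: coeff_eq_0)
  finally show ?thesis by simp
qed

lemma falling_basis_exists:
  "degree p \<le> n \<Longrightarrow> \<exists>c. (\<forall>k>n. c k = 0) \<and> p = (\<Sum>k\<le>n. smult (c k) (falling pvar k))"
proof (induction n arbitrary: p)
  case 0
  then obtain a where "p = [:a:]" by (auto elim: degree_eq_zeroE)
  then show ?case
    by (intro exI[of _ "\<lambda>k. if k = 0 then a else 0"]) (simp add: falling_def)
next
  case (Suc n)
  define a where "a = coeff p (Suc n)"
  define q where "q = p - smult a (falling pvar (Suc n))"
  have "degree q \<le> n"
  proof (rule degree_le, intro allI impI)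
    fix i assume "n < i"
    show "coeff q i = 0"
    proof (cases "i = Suc n")
      case True
      then show ?thesis by (simp add: q_def a_def falling_pvar_lead)
    next
      case False
      with \<open>n < i\<close> Suc.prems show ?thesis
        by (simp add: q_def coeff_eq_0 falling_pvar_degree)
    qed
  qed
  from Suc.IH[OF this] obtain c where c: "\<forall>k>n. c k = 0"
    "q = (\<Sum>k\<le>n. smult (c k) (falling pvar k))" by blast
  have "p = q + smult a (falling pvar (Suc n))" by (simp add: q_def)
  with c show ?case
    by (intro exI[of _ "c(Suc n := a)"]) simp
qed

lemma falling_basis_unique:
  "(\<Sum>k\<le>n. smult (c k) (falling pvar k)) = (\<Sum>k\<le>n. smult (d k) (falling pvar k)) \<Longrightarrow>
     k \<le> n \<Longrightarrow> c k = d k"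
proof (induction n)
  case 0
  then show ?case using coeff_falling_sum[of c 0] coeff_falling_sum[of d 0] by simp
next
  case (Suc n)
  have "c (Suc n) = d (Suc n)"
    using Suc.prems(1) coeff_falling_sum[of c "Suc n"] coeff_falling_sum[of d "Suc n"] by simp
  with Suc show ?case by (cases "k = Suc n") auto
qed

lemma degree_degen_rising: "degree (degen_rising [:lam:] (pvar + of_nat r) n) \<le> n"
proof (induction n)
  case 0
  then show ?case by (simp add: degen_rising_def)
next
  case (Suc n)
  have lin: "pvar + of_nat r + of_nat n * [:lam:] = [:real r + real n * lam, 1:]"
    by (simp add: of_nat_poly)
  have rec: "degen_rising [:lam:] (pvar + of_nat r) (Suc n)
      = degen_rising [:lam:] (pvar + of_nat r) n * [:real r + real n * lam, 1:]"
    unfolding degen_rising_def by (simp only: prod.lessThan_Suc lin)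
  have "degree [:real r + real n * lam, 1:] = 1" by simp
  with Suc show ?case unfolding rec
    using degree_mult_le[of "degen_rising [:lam:] (pvar + of_nat r) n" "[:real r + real n * lam, 1:]"]
    by linarith
qed

lemma het_stirling_ex1:
  "\<exists>!c. (\<forall>k>n. c k = 0) \<and>
     degen_rising [:lam:] (pvar + of_nat r) n = (\<Sum>k\<le>n. smult (c k) (falling pvar k))"
proof (rule ex_ex1I)
  show "\<exists>c. (\<forall>k>n. c k = 0) \<and>
     degen_rising [:lam:] (pvar + of_nat r) n = (\<Sum>k\<le>n. smult (c k) (falling pvar k))"
    by (rule falling_basis_exists[OF degree_degen_rising])
next
  fix c d :: "nat \<Rightarrow> real"
  assume c: "(\<forall>k>n. c k = 0) \<and>
     degen_rising [:lam:] (pvar + of_nat r) n = (\<Sum>k\<le>n. smult (c k) (falling pvar k))"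
    and d: "(\<forall>k>n. d k = 0) \<and>
     degen_rising [:lam:] (pvar + of_nat r) n = (\<Sum>k\<le>n. smult (d k) (falling pvar k))"
  show "c = d"
  proof
    fix k
    show "c k = d k"
      using c d falling_basis_unique[of c n d k] by (cases "k \<le> n") auto
  qed
qed

lemma het_stirling_identity:
  "degen_rising [:lam:] (pvar + of_nat r) n
     = (\<Sum>k\<le>n. smult (het_stirling lam r n k) (falling pvar k))"
  using theI'[OF het_stirling_ex1[of n lam r]] unfolding het_stirling_def by blast

end

theory Submission
  imports Defs
begin

text \<open>Put \<open>G = e\<^sub>\<lambda>\<^sup>-\<^sup>1(-t) - 1\<close>. Comparing powers of \<open>x\<close>, the claim says that
  \<open>G\<^sup>k e\<^sub>\<lambda>\<^sup>-\<^sup>r(-t) / k!\<close> is the exponential generating function of the numbers \<open>H(n + r, k + r)\<close>.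
  Its coefficients satisfy the defining identity of these numbers at every natural number
  \<open>x = j\<close>, because \<open>(1 + G)\<^sup>j e\<^sub>\<lambda>\<^sup>-\<^sup>r(-t) = e\<^sub>\<lambda>\<^sup>-\<^sup>(\<^sup>j\<^sup>+\<^sup>r\<^sup>)(-t)\<close> expands binomially;
  hence they satisfy it as a polynomial identity, and expansions in falling factorials are unique.\<close>

text \<open>A nonzero difference has only finitely many roots, while \<open>of_nat\<close> has
  infinite range in characteristic 0.\<close>

lemma poly_eqI_nat:
  fixes p q :: "'a::{idom,ring_char_0} poly"
  assumes "\<And>j::nat. poly p (of_nat j) = poly q (of_nat j)"
  shows "p = q"
proof (rule ccontr)
  assume "p \<noteq> q"
  then have "finite {x. poly (p - q) x = 0}" by (intro poly_roots_finite) simp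
  moreover have "range of_nat \<subseteq> {x. poly (p - q) x = 0}" using assms by auto
  ultimately have "finite (range (of_nat :: nat \<Rightarrow> 'a))" by (rule rev_finite_subset)
  then show False using infinite_UNIV_char_0 finite_imageD inj_of_nat by blast
qed

lemma poly_falling_of_nat: "poly (falling pvar k) (real j) = fact k * real (j choose k)"
proof -
  have "poly (falling pvar k) (real j) = (\<Prod>i<k. real j - real i)"
    by (simp add: falling_def poly_prod)
  also have "\<dots> = fact k * (real j gchoose k)"
    by (simp add: gbinomial_mult_fact atLeast0LessThan)
  finally show ?thesis by (simp add: binomial_gbinomial)
qed

lemma poly_degen_rising:
  "poly (degen_rising [:lam:] (pvar + of_nat r) n) x = degen_rising lam (x + real r) n"
  by (simp add: degen_rising_def poly_prod mult.commute)

text \<open>The closed form \<open>(1 + lam t)^(x / lam)\<close>, obtained by pulling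
  \<open>lam\<close> out of each factor of \<open>degen_falling\<close>. It lets
  \<open>degen_exp\<close> inherit the exponent law of the binomial series.\<close>

lemma degen_exp_eq_binomial:
  assumes "lam \<noteq> 0"
  shows "degen_exp lam x = fps_binomial (x / lam) oo (fps_const lam * fps_X)"
proof (rule fps_ext)
  fix n
  have "degen_falling lam x n = (\<Prod>i<n. lam * (x / lam - of_nat i))"
    unfolding degen_falling_def using assms by (intro prod.cong) (auto simp: field_simps)
  also have "\<dots> = lam ^ n * (fact n * (x / lam gchoose n))"
    by (simp add: prod.distrib gbinomial_mult_fact atLeast0LessThan)
  finally show "degen_exp lam x $ n = (fps_binomial (x / lam) oo (fps_const lam * fps_X)) $ n"
    by (simp add: degen_exp_def fps_compose_linear)
qed

lemma degen_exp_add: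
  assumes "lam \<noteq> 0"
  shows "degen_exp lam (x + y) = degen_exp lam x * degen_exp lam y"
  by (simp add: degen_exp_eq_binomial[OF assms] add_divide_distrib fps_binomial_add_mult
      fps_compose_mult_distrib)

text \<open>This is \<open>(1 - lam t)^(- x / lam)\<close>. Negating both the exponent and the
  variable turns the falling factorials in the coefficients into rising ones.\<close>

definition degen_exp_reflect :: "real \<Rightarrow> real \<Rightarrow> real fps" where
  "degen_exp_reflect lam x = degen_exp lam (- x) oo (- fps_X)"

lemma degen_exp_reflect_nth: "degen_exp_reflect lam x $ n = degen_rising lam x n / fact n"
proof -
  have "degen_exp_reflect lam x $ n = (-1) ^ n * (degen_falling lam (- x) n / fact n)"
    using fps_compose_linear[of "degen_exp lam (- x)" "-1"]
    by (simp add: degen_exp_reflect_def degen_exp_def flip: fps_const_neg)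
  \<comment> \<open>The sign \<open>(-1) ^ n\<close> is distributed over the product, one
    \<open>-1\<close> for each of the \<open>n\<close> factors.\<close>
  also have "\<dots> = (\<Prod>i<n. (-1) * (- x - of_nat i * lam)) / fact n"
    unfolding prod.distrib by (simp add: degen_falling_def)
  also have "\<dots> = degen_rising lam x n / fact n"
    by (simp add: degen_rising_def add.commute)
  finally show ?thesis .
qed

lemma degen_exp_reflect_add:
  assumes "lam \<noteq> 0"
  shows "degen_exp_reflect lam (x + y) = degen_exp_reflect lam x * degen_exp_reflect lam y"
  using degen_exp_add[OF assms, of "- x" "- y"]
  by (simp add: degen_exp_reflect_def fps_compose_mult_distrib)

lemma degen_exp_reflect_0: "degen_exp_reflect lam 0 = 1"
  by (rule fps_ext)
    (auto simp: degen_exp_reflect_nth degen_rising_def lessThan_Suc_eq_insert_0 gr0_conv_Suc)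

lemma degen_exp_reflect_of_nat:
  assumes "lam \<noteq> 0"
  shows "degen_exp_reflect lam (real j) = degen_exp_reflect lam 1 ^ j"
  by (induction j) (simp_all add: degen_exp_reflect_0 degen_exp_reflect_add[OF assms])

lemma het_stirling_egf:
  assumes "lam \<noteq> 0" and "k \<le> n"
  shows "((degen_exp_reflect lam 1 - 1) ^ k * degen_exp_reflect lam (real r)) $ n
           = fact k * het_stirling lam r n k / fact n"
proof -
  define G where "G = degen_exp_reflect lam 1 - 1"
  define R where "R = degen_exp_reflect lam (real r)"
  \<comment> \<open>The value predicted for \<open>het_stirling lam r n k\<close>, taken for every
    \<open>k\<close> because the binomial expansion below runs up to an arbitrary
    \<open>j\<close>.\<close>
  define c where "c k = fact n * (G ^ k * R) $ n / fact k" for k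
  have G0: "G $ 0 = 0" by (simp add: G_def degen_exp_reflect_nth degen_rising_def)
  \<comment> \<open>As \<open>G\<close> has no constant term, \<open>G ^ k\<close> has no terms
    below degree \<open>k\<close>.\<close>
  have c0: "c k = 0" if "k > n" for k
  proof -
    have "(G ^ k * R) $ n = (\<Sum>i=0..n. G ^ k $ i * R $ (n - i))" by (rule fps_mult_nth)
    also have "\<dots> = 0"
      using that startsby_zero_power_prefix[OF G0] by (intro sum.neutral) auto
    finally show ?thesis by (simp add: c_def)
  qed
  have "(\<Sum>k\<le>n. smult (c k) (falling pvar k)) = degen_rising [:lam:] (pvar + of_nat r) n"
  proof (rule poly_eqI_nat)
    fix j
    have "degen_rising lam (real j + real r) n = fact n * ((G + 1) ^ j * R) $ n"
      using degen_exp_reflect_nth[of lam "real j + real r" n]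
      by (simp add: degen_exp_reflect_add[OF assms(1)] degen_exp_reflect_of_nat[OF assms(1)]
          G_def R_def del: of_nat_add)
    also have "(G + 1) ^ j * R = (\<Sum>k\<le>j. of_nat (j choose k) * (G ^ k * R))"
      by (simp add: binomial_ring sum_distrib_right mult.assoc)
    also have "fact n * \<dots> $ n = (\<Sum>k\<le>j. c k * (fact k * real (j choose k)))"
      by (simp add: fps_sum_nth sum_distrib_left c_def) (simp add: mult_ac)
    \<comment> \<open>The bound \<open>j\<close> is exchanged for \<open>n\<close> through the
      common bound \<open>n + j\<close>: the terms added have \<open>k > j\<close>, where
      \<open>j choose k\<close> is 0, and the terms then dropped have \<open>k > n\<close>, where
      \<open>c0\<close> applies.\<close>
    also have "\<dots> = (\<Sum>k\<le>n + j. c k * (fact k * real (j choose k)))"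
      by (rule sum.mono_neutral_left) auto
    also have "\<dots> = (\<Sum>k\<le>n. c k * (fact k * real (j choose k)))"
      by (rule sum.mono_neutral_right) (auto simp: c0)
    finally show "poly (\<Sum>k\<le>n. smult (c k) (falling pvar k)) (of_nat j)
        = poly (degen_rising [:lam:] (pvar + of_nat r) n) (of_nat j)"
      by (simp add: poly_degen_rising poly_sum poly_falling_of_nat)
  qed
  then have "c k = het_stirling lam r n k"
    using assms(2) by (intro falling_basis_unique[of c n]) (simp_all add: het_stirling_identity)
  then show ?thesis by (auto simp: c_def G_def R_def field_simps)
qed

lemma fps_lift_nth [simp]: "fps_lift f $ n = [:f $ n:]"
  by (simp add: fps_lift_def)

lemma fps_lift_1 [simp]: "fps_lift 1 = 1"
  by (rule fps_ext) (simp add: one_pCons)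

lemma fps_lift_diff: "fps_lift (f - g) = fps_lift f - fps_lift g"
  by (rule fps_ext) simp

lemma sum_const_poly: "(\<Sum>i\<in>A. [:f i:]) = [:\<Sum>i\<in>A. f i:]"
  by (induction A rule: infinite_finite_induct) simp_all

lemma fps_lift_mult: "fps_lift (f * g) = fps_lift f * fps_lift g"
  by (rule fps_ext) (simp add: fps_mult_nth mult.commute flip: sum_const_poly)

lemma fps_lift_power: "fps_lift (f ^ k) = fps_lift f ^ k"
  by (induction k) (simp_all add: fps_lift_mult)

lemma smult_sum_right: "smult a (\<Sum>i\<in>A. f i) = (\<Sum>i\<in>A. smult a (f i))"
  by (induction A rule: infinite_finite_induct) (simp_all add: smult_add_right)

text \<open>This separates the powers of \<open>p\<close> from the real series, so that only real
  coefficients remain to be computed. As \<open>g ^ k\<close> starts in degree \<open>k\<close> or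
  later, every coefficient of the composition up to degree \<open>n\<close> can be summed over the
  same range \<open>k \<le> n\<close>; swapping the sums then leaves the convolution of
  \<open>g ^ k\<close> with \<open>h\<close>.\<close>

lemma fps_lift_compose_mult_nth:
  assumes "g $ 0 = 0"
  shows "((fps_lift f oo (fps_const p * fps_lift g)) * fps_lift h) $ n
           = (\<Sum>k\<le>n. smult (f $ k * (g ^ k * h) $ n) (p ^ k))"
proof -
  have comp: "(fps_lift f oo (fps_const p * fps_lift g)) $ i
      = (\<Sum>k\<le>n. smult (f $ k * g ^ k $ i) (p ^ k))" if "i \<le> n" for i
  proof -
    have "(fps_lift f oo (fps_const p * fps_lift g)) $ i
        = (\<Sum>k=0..i. smult (f $ k * g ^ k $ i) (p ^ k))"
      by (simp add: fps_compose_nth power_mult_distrib fps_const_power mult.commute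
          flip: fps_lift_power)
    also have "\<dots> = (\<Sum>k\<le>n. smult (f $ k * g ^ k $ i) (p ^ k))"
      using that startsby_zero_power_prefix[OF assms]
      by (intro sum.mono_neutral_left) auto
    finally show ?thesis .
  qed
  have "((fps_lift f oo (fps_const p * fps_lift g)) * fps_lift h) $ n
      = (\<Sum>i=0..n. \<Sum>k\<le>n. smult (f $ k * (g ^ k $ i * h $ (n - i))) (p ^ k))"
    unfolding fps_mult_nth[of _ "fps_lift h"]
    by (intro sum.cong refl) (simp add: comp smult_sum_right, simp add: mult_ac)
  also have "\<dots> = (\<Sum>k\<le>n. smult (f $ k * (g ^ k * h) $ n) (p ^ k))"
    by (subst sum.swap) (simp add: fps_mult_nth sum_distrib_left smult_sum)
  finally show ?thesis .
qed

theorem mainTheorem14: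
  fixes lam :: real and r :: nat
  assumes "lam \<noteq> 0" and "r \<ge> 1"
  shows "(fps_lift (fps_exp 1) oo
            (fps_const pvar * (fps_lift (degen_exp lam (-1) oo (- fps_X)) - 1)))
          * fps_lift (degen_exp lam (- real r) oo (- fps_X))
         = Abs_fps (\<lambda>n. smult (1 / fact n) (het_bell lam r n))"
proof (rule fps_ext)
  fix n
  let ?G = "degen_exp_reflect lam 1 - 1" and ?R = "degen_exp_reflect lam (real r)"
  have "?G $ 0 = 0" by (simp add: degen_exp_reflect_nth degen_rising_def)
  then have "((fps_lift (fps_exp 1) oo (fps_const pvar * fps_lift ?G)) * fps_lift ?R) $ n
      = (\<Sum>k\<le>n. smult (fps_exp 1 $ k * (?G ^ k * ?R) $ n) (pvar ^ k))"
    by (rule fps_lift_compose_mult_nth)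
  \<comment> \<open>The coefficient \<open>1 / fact k\<close> of \<open>fps_exp 1\<close> cancels
    the \<open>fact k\<close> from \<open>het_stirling_egf\<close>.\<close>
  also have "\<dots> = smult (1 / fact n) (het_bell lam r n)"
    by (simp add: het_bell_def smult_sum_right het_stirling_egf[OF assms(1)])
  finally show "((fps_lift (fps_exp 1) oo
            (fps_const pvar * (fps_lift (degen_exp lam (-1) oo (- fps_X)) - 1)))
          * fps_lift (degen_exp lam (- real r) oo (- fps_X))) $ n
         = Abs_fps (\<lambda>n. smult (1 / fact n) (het_bell lam r n)) $ n"
    by (simp add: degen_exp_reflect_def fps_lift_diff)
qed

end
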